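(* Let $X$ be a nonzero Banach space which is almost square (ASQ). Then for every finite dimensional subspace $E$ of $X$ and every $\varepsilon>0$ there exists a subspace $Y$ of $X$ which is $\varepsilon$-isometric to $c_0$ such that $E\oplus Y$ (the direct sum taken inside $X$, with the norm of $X$) is $\varepsilon$-isometric to $E\oplus_\infty c_0$.
   Context: All Banach spaces are real. $S_X$ and $B_X$ denote the unit sphere and closed unit ball of $X$. A Banach space $X$ is almost square (ASQ) if for every finite subset $(x_i)_{i=1}^N \subset S_X$ there exists a sequence $(y_n)\subset B_X$ such that $\|x_i\pm y_n\|\to 1$ for every $i=1,\ldots,N$ and $\|y_n\|\to 1$. Two normed spaces $V$ and $W$ are $\varepsilon$-isometric if there is a linear isomorphism $T$ from $W$ onto $V$ with $(1-\varepsilon)\|w\|\le\|Tw\|\le(1+\varepsilon)\|w\|$ for all $w\in W$. $E\oplus_\infty c_0$ denotes the direct sum with norm $\|(e,a)\|=\max\{\|e\|,\|a\|\}$. *)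

theory Defs
  imports "HOL-Analysis.Analysis"
begin

definition almost_square :: "'a::banach itself \<Rightarrow> bool" where
  "almost_square _ \<longleftrightarrow>
     (\<forall>F::'a set. finite F \<and> F \<subseteq> sphere 0 1 \<longrightarrow>
        (\<exists>y::nat \<Rightarrow> 'a. (\<forall>n. y n \<in> cball 0 1) \<and>
           (\<forall>x\<in>F. (\<lambda>n. norm (x + y n)) \<longlonglongrightarrow> 1 \<and> (\<lambda>n. norm (x - y n)) \<longlonglongrightarrow> 1) \<and>
           (\<lambda>n. norm (y n)) \<longlonglongrightarrow> 1))"

text \<open>Since the topology of \<^typ>\<open>nat\<close> is discrete, \<^typ>\<open>nat \<Rightarrow>\<^sub>C real\<close> is the space of all bounded
  real sequences with the supremum norm; \<open>c\<^sub>0\<close> is its subspace of null sequences.\<close>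

definition c0 :: "(nat \<Rightarrow>\<^sub>C real) set" where
  "c0 = {a. apply_bcontfun a \<longlonglongrightarrow> 0}"

text \<open>The norms are explicit arguments because the library norm on a product type is the Euclidean
  one, so that the maximum norm on a product has to be passed separately. The values of \<open>T\<close>
  outside \<open>W\<close> are irrelevant.\<close>

definition eps_isometric ::
    "real \<Rightarrow> 'v::real_vector set \<Rightarrow> ('v \<Rightarrow> real) \<Rightarrow> 'w::real_vector set \<Rightarrow> ('w \<Rightarrow> real) \<Rightarrow> bool" where
  "eps_isometric \<epsilon> V normV W normW \<longleftrightarrow>
     (\<exists>T::'w \<Rightarrow> 'v.
        bij_betw T W V \<and>
        (\<forall>u\<in>W. \<forall>w\<in>W. T (u + w) = T u + T w) \<and>
        (\<forall>r. \<forall>w\<in>W. T (r *\<^sub>R w) = r *\<^sub>R T w) \<and>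
        (\<forall>w\<in>W. (1 - \<epsilon>) * normW w \<le> normV (T w) \<and> normV (T w) \<le> (1 + \<epsilon>) * normW w))"

definition max_norm :: "'a::real_normed_vector \<times> 'b::real_normed_vector \<Rightarrow> real" where
  "max_norm p = max (norm (fst p)) (norm (snd p))"

end

theory Submission
  imports Defs
begin

text \<open>An almost square space has the one-step property that a finite dimensional subspace \<open>F\<close> and
  a suitable vector \<open>y\<close> span \<open>F \<oplus>\<^sub>\<infinity> \<real>\<close> up to a factor \<open>1 \<plusminus> \<delta>\<close>: the bound
  \<open>\<parallel>s \<plusminus> y\<parallel> \<le> 1 + \<delta>\<close> passes from a finite net to the whole unit sphere of \<open>F\<close>, convexity
  gives the upper estimate, and the lower one follows by averaging \<open>e + t y\<close> with
  \<open>e - t y\<close> or its negative. Iterating with \<open>\<delta>\<^sub>n = \<epsilon> 2\<^sup>-\<^sup>n\<^sup>-\<^sup>2\<close> yields a sequence \<open>y\<^sub>n\<close> equivalent to the unit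
  vector basis of \<open>c\<^sub>0\<close> over \<open>E\<close>, and \<open>(e, a) \<mapsto> e + \<Sum> a\<^sub>n y\<^sub>n\<close> is the required map.\<close>

section \<open>Compactness of balls in finite dimensional spans\<close>

text \<open>A convergent sequence is bounded, so it lies in a single slice, which is compact and
  therefore contains the limit. This is what puts a vector outside a finite dimensional span at
  positive distance from it.\<close>

lemma closed_if_compact_Int_cball:
  fixes S :: "'a::real_normed_vector set"
  assumes "\<And>r. compact (S \<inter> cball 0 r)"
  shows "closed S"
proof (unfold closed_sequential_limits, intro allI impI)
  fix f l assume fl: "(\<forall>n. f n \<in> S) \<and> f \<longlonglongrightarrow> l"
  then have "Bseq f" by (meson convergent_def convergent_imp_Bseq)
  then obtain r where "\<And>n. norm (f n) \<le> r" by (auto simp: Bseq_def)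
  with fl have "\<And>n. f n \<in> S \<inter> cball 0 r" by auto
  with fl assms[of r] show "l \<in> S"
    by (meson IntD1 closed_sequentially compact_imp_closed)
qed

text \<open>Induction on \<open>B\<close>, with \<open>r\<close> arbitrary because the radius grows.
  A new \<open>x\<close> has distance \<open>d > 0\<close> from \<open>span B\<close>, so its
  coefficient in a vector of norm at most \<open>r\<close> is at most \<open>r / d\<close>, and the
  ball of the larger span is covered by a continuous image of a compact product.\<close>

lemma compact_span_Int_cball:
  fixes B :: "'a::real_normed_vector set"
  assumes "finite B"
  shows "compact (span B \<inter> cball 0 r)"
  using assms
proof (induction B arbitrary: r rule: finite_induct)
  case empty
  have "span {} \<inter> cball 0 r = (if r \<ge> 0 then {0::'a} else {})" by auto
  then show ?case by auto
next
  case (insert x B)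
  show ?case
  proof (cases "x \<in> span B")
    case True
    then show ?thesis using insert.IH by (simp add: span_redundant)
  next
    case False
    have cl: "closed (span B)"
      by (rule closed_if_compact_Int_cball[OF insert.IH])
    define d where "d = infdist x (span B)"
    have ne: "span B \<noteq> {}" using span_zero by blast
    have d: "d > 0"
      using False cl ne unfolding d_def by (metis in_closed_iff_infdist_zero infdist_nonneg le_less)
    \<comment> \<open>For nonzero \<open>t\<close> the vector \<open>s + t x\<close> is
      \<open>t\<close> times the difference of \<open>x\<close> and a point of
      \<open>span B\<close>.\<close>
    have est: "\<bar>t\<bar> * d \<le> norm (s + t *\<^sub>R x)" if "s \<in> span B" for s t
    proof (cases "t = 0")
      case False
      have "- (inverse t) *\<^sub>R s \<in> span B" using that by (rule span_scale)
      then have "d \<le> dist x (- (inverse t) *\<^sub>R s)"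
        unfolding d_def by (rule infdist_le)
      then have "\<bar>t\<bar> * d \<le> \<bar>t\<bar> * norm (x + inverse t *\<^sub>R s)"
        by (simp add: dist_norm mult_left_mono)
      also have "\<dots> = norm (t *\<^sub>R (x + inverse t *\<^sub>R s))" by simp
      also have "t *\<^sub>R (x + inverse t *\<^sub>R s) = s + t *\<^sub>R x"
        using False by (simp add: scaleR_right_distrib)
      finally show ?thesis .
    qed simp
    \<comment> \<open>\<open>R\<close> bounds \<open>z - t x\<close> when \<open>z\<close> has norm
      at most \<open>r\<close> and \<open>t\<close> is at most \<open>r / d\<close> in absolute
      value.\<close>
    define R where "R = r + r / d * norm x"
    define K where "K = (\<lambda>(s, t). s + t *\<^sub>R x) ` ((span B \<inter> cball 0 R) \<times> {- (r / d)..r / d})"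
    have "compact K"
      unfolding K_def
      by (intro compact_continuous_image compact_Times insert.IH)
         (auto simp: case_prod_unfold intro!: continuous_intros)
    \<comment> \<open>\<open>K\<close> may reach beyond the ball of radius \<open>r\<close>; cutting
      it down again by a closed ball keeps it compact.\<close>
    moreover have "span (insert x B) \<inter> cball 0 r = K \<inter> cball 0 r"
    proof (intro equalityI subsetI)
      fix z assume z: "z \<in> span (insert x B) \<inter> cball 0 r"
      then obtain t where t: "z - t *\<^sub>R x \<in> span B" by (auto simp: span_insert)
      have "\<bar>t\<bar> * d \<le> r" using est[OF t, of t] z by simp
      then have t': "\<bar>t\<bar> \<le> r / d" using d by (simp add: field_simps)
      have "norm (z - t *\<^sub>R x) \<le> norm z + \<bar>t\<bar> * norm x"
        using norm_triangle_ineq4[of z "t *\<^sub>R x"] by simp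
      also have "\<dots> \<le> R"
        unfolding R_def using z t' by (intro add_mono mult_right_mono) auto
      finally have "(z - t *\<^sub>R x, t) \<in> (span B \<inter> cball 0 R) \<times> {- (r / d)..r / d}"
        using t t' by auto
      then have "z \<in> K" unfolding K_def by (rule rev_image_eqI) simp
      then show "z \<in> K \<inter> cball 0 r" using z by simp
    next
      fix z assume z: "z \<in> K \<inter> cball 0 r"
      then obtain s t where "s \<in> span B" "z = s + t *\<^sub>R x" by (auto simp: K_def)
      then show "z \<in> span (insert x B) \<inter> cball 0 r"
        using z by (auto simp: span_insert intro!: exI[of _ t])
    qed
    ultimately show ?thesis by (simp add: compact_Int_closed)
  qed
qed

section \<open>Extension by one vector\<close>

text \<open>Put \<open>s = e / norm e\<close> for nonzero \<open>e\<close>. If \<open>t\<close> is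
  at most \<open>norm e\<close> in absolute value, \<open>e + t y\<close> combines
  \<open>s + y\<close> and \<open>s - y\<close> with nonnegative weights of total
  \<open>norm e\<close>. Otherwise it combines one of \<open>s + y\<close>, \<open>s - y\<close>
  (chosen by the sign of \<open>t\<close>) with \<open>y\<close> or \<open>- y\<close>, the weights
  having total \<open>\<bar>t\<bar>\<close>.\<close>

lemma norm_add_scaleR_le_max:
  fixes y :: "'a::real_normed_vector"
  assumes "norm y \<le> 1" "c \<ge> 1" "subspace S" "e \<in> S"
    and sph: "\<And>s. s \<in> S \<Longrightarrow> norm s = 1 \<Longrightarrow> norm (s + y) \<le> c \<and> norm (s - y) \<le> c"
  shows "norm (e + t *\<^sub>R y) \<le> c * max (norm e) \<bar>t\<bar>"
proof (cases "e = 0")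
  case True
  have "\<bar>t\<bar> * norm y \<le> \<bar>t\<bar>" using assms(1) by (simp add: mult_left_le)
  also have "\<dots> \<le> c * \<bar>t\<bar>" using assms(2) by (simp add: mult_le_cancel_right1)
  finally show ?thesis using True by simp
next
  case False
  define m where "m = norm e"
  define s where "s = inverse m *\<^sub>R e"
  have m: "m > 0" using False by (simp add: m_def)
  have e: "e = m *\<^sub>R s" using m by (simp add: s_def)
  have "s \<in> S" "norm s = 1"
    using m assms(3,4) by (auto simp: s_def subspace_scale) (simp add: m_def)
  then have s: "norm (s + y) \<le> c" "norm (s - y) \<le> c" using sph by auto
  show ?thesis
  proof (cases "\<bar>t\<bar> \<le> m")
    case True
    have "e + t *\<^sub>R y = ((m + t) / 2) *\<^sub>R (s + y) + ((m - t) / 2) *\<^sub>R (s - y)"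
      by (simp add: e algebra_simps add_divide_distrib diff_divide_distrib)
         (simp flip: scaleR_left_distrib)
    also have "norm \<dots> \<le> (m + t) / 2 * norm (s + y) + (m - t) / 2 * norm (s - y)"
      using True by (intro norm_triangle_le) auto
    also have "\<dots> \<le> (m + t) / 2 * c + (m - t) / 2 * c"
      using True s by (intro add_mono mult_left_mono) auto
    also have "\<dots> = c * m" by (simp add: field_simps)
    finally show ?thesis using True by (simp add: m_def max_def)
  next
    case F: False
    define \<sigma> where "\<sigma> = sgn t"
    have t: "t = \<sigma> * \<bar>t\<bar>" "\<bar>\<sigma>\<bar> = 1" using F m by (auto simp: \<sigma>_def sgn_mult_abs sgn_if)
    have sg: "norm (s + \<sigma> *\<^sub>R y) \<le> c" using s F m by (auto simp: \<sigma>_def sgn_if)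
    have "m *\<^sub>R (s + \<sigma> *\<^sub>R y) + (\<sigma> * (\<bar>t\<bar> - m)) *\<^sub>R y = e + (\<sigma> * \<bar>t\<bar>) *\<^sub>R y"
      by (simp add: e algebra_simps)
    then have "e + t *\<^sub>R y = m *\<^sub>R (s + \<sigma> *\<^sub>R y) + (\<sigma> * (\<bar>t\<bar> - m)) *\<^sub>R y"
      using t(1) by simp
    also have "norm \<dots> \<le> m * norm (s + \<sigma> *\<^sub>R y) + (\<bar>t\<bar> - m) * norm y"
      using F m t(2) by (intro norm_triangle_le) (simp add: abs_mult)
    also have "\<dots> \<le> m * c + (\<bar>t\<bar> - m) * c"
      using F m sg assms(1,2) by (intro add_mono mult_left_mono) auto
    also have "\<dots> = c * \<bar>t\<bar>" by (simp add: algebra_simps)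
    finally show ?thesis using F by (simp add: m_def max_def)
  qed
qed

text \<open>Stated for the span of a finite set, so that the new vector can be inserted into the set
  and the lemma applied again.\<close>

lemma almost_square_extend:
  fixes B :: "'a::banach set"
  assumes "almost_square TYPE('a)" "finite B" "\<delta> > 0"
  shows "\<exists>y. \<forall>e\<in>span B. \<forall>t. (1 - \<delta>) * max (norm e) \<bar>t\<bar> \<le> norm (e + t *\<^sub>R y) \<and>
                          norm (e + t *\<^sub>R y) \<le> (1 + \<delta>) * max (norm e) \<bar>t\<bar>"
proof -
  \<comment> \<open>One \<open>\<eta>\<close> is lost in the almost square sequence and one in the
    net, giving the upper constant \<open>1 + 2 * \<eta>\<close>. Averaging then gives the lower
    constant \<open>2 * (1 - \<eta>) - (1 + 2 * \<eta>) = 1 - 4 * \<eta>\<close>.\<close>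
  define \<eta> where "\<eta> = \<delta> / 4"
  have \<eta>: "\<eta> > 0" using assms(3) by (simp add: \<eta>_def)
  have "span B \<inter> sphere 0 1 = (span B \<inter> cball 0 1) - ball 0 1" by auto
  then have "compact (span B \<inter> sphere 0 1)"
    by (simp add: compact_diff compact_span_Int_cball assms(2))
  then obtain F where F: "finite F" "F \<subseteq> span B \<inter> sphere 0 1"
      "span B \<inter> sphere 0 1 \<subseteq> (\<Union>x\<in>F. ball x \<eta>)"
    using seq_compact_imp_totally_bounded \<eta> compact_eq_seq_compact_metric by metis
  obtain z where z: "\<And>n. z n \<in> cball 0 1" "(\<lambda>n. norm (z n)) \<longlonglongrightarrow> 1"
    and zF: "\<And>x. x \<in> F \<Longrightarrow> (\<lambda>n. norm (x + z n)) \<longlonglongrightarrow> 1"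
      "\<And>x. x \<in> F \<Longrightarrow> (\<lambda>n. norm (x - z n)) \<longlonglongrightarrow> 1"
    using assms(1) F(1,2) unfolding almost_square_def by (metis le_inf_iff)
  \<comment> \<open>Since the net is finite, a single index serves all its points at once.\<close>
  have "\<forall>\<^sub>F n in sequentially. (\<forall>x\<in>F. norm (x + z n) < 1 + \<eta> \<and> norm (x - z n) < 1 + \<eta>) \<and>
      norm (z n) > 1 - \<eta>"
    using z(2) zF F(1) \<eta>
    by (intro eventually_conj eventually_ball_finite ballI order_tendstoD) auto
  then obtain n where n: "\<And>x. x \<in> F \<Longrightarrow> norm (x + z n) < 1 + \<eta>"
      "\<And>x. x \<in> F \<Longrightarrow> norm (x - z n) < 1 + \<eta>" "norm (z n) > 1 - \<eta>"
    using eventually_happens'[OF sequentially_bot] by blast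
  define y where "y = z n"
  have y1: "norm y \<le> 1" using z(1)[of n] by (simp add: y_def)
  have sph: "norm (s + y) \<le> 1 + 2 * \<eta> \<and> norm (s - y) \<le> 1 + 2 * \<eta>"
    if "s \<in> span B" "norm s = 1" for s
  proof -
    have "s \<in> (\<Union>x\<in>F. ball x \<eta>)" using that by (intro subsetD[OF F(3)]) simp
    then obtain x where x: "x \<in> F" "norm (x - s) < \<eta>" by (auto simp: dist_norm)
    have "norm (s + y) \<le> norm (x + y) + norm (x - s)"
      using norm_triangle_ineq4[of "x + y" "x - s"] by (simp add: add.commute)
    moreover have "norm (s - y) \<le> norm (x - y) + norm (x - s)"
      using norm_triangle_ineq4[of "x - y" "x - s"] by simp
    ultimately show ?thesis
      using n(1,2)[OF x(1)] x(2) by (simp add: y_def)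
  qed
  have up: "norm (e + t *\<^sub>R y) \<le> (1 + 2 * \<eta>) * max (norm e) \<bar>t\<bar>" if "e \<in> span B" for e t
    by (rule norm_add_scaleR_le_max[OF y1 _ subspace_span that sph]) (use \<eta> in auto)
  have lo: "(1 - 4 * \<eta>) * max (norm e) \<bar>t\<bar> \<le> norm (e + t *\<^sub>R y)" if "e \<in> span B" for e t
  proof -
    define M where "M = max (norm e) \<bar>t\<bar>"
    have "2 * norm e = norm ((e + t *\<^sub>R y) + (e - t *\<^sub>R y))"
      by (simp flip: scaleR_2)
    then have 1: "2 * norm e \<le> norm (e + t *\<^sub>R y) + norm (e - t *\<^sub>R y)"
      using norm_triangle_ineq by metis
    have "2 * (\<bar>t\<bar> * norm y) = norm ((e + t *\<^sub>R y) - (e - t *\<^sub>R y))"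
      by (simp add: abs_mult flip: scaleR_2)
    then have 2: "2 * (\<bar>t\<bar> * norm y) \<le> norm (e + t *\<^sub>R y) + norm (e - t *\<^sub>R y)"
      using norm_triangle_ineq4 by metis
    have "\<bar>t\<bar> * (1 - \<eta>) \<le> \<bar>t\<bar> * norm y"
      using n(3) by (intro mult_left_mono) (auto simp: y_def)
    moreover have "norm e * (1 - \<eta>) \<le> norm e"
      using \<eta> by (simp add: mult_left_le)
    ultimately have "2 * (M * (1 - \<eta>)) \<le> norm (e + t *\<^sub>R y) + norm (e - t *\<^sub>R y)"
      using 1 2 by (auto simp: M_def max_def)
    \<comment> \<open>The other summand is bounded above by \<open>up\<close> at \<open>- t\<close>;
      subtracting this bound leaves the lower estimate.\<close>
    moreover have "norm (e - t *\<^sub>R y) \<le> (1 + 2 * \<eta>) * M"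
      using up[OF that, of "- t"] by (simp add: M_def)
    ultimately show ?thesis unfolding M_def[symmetric] by (simp add: algebra_simps)
  qed
  have "(1 + 2 * \<eta>) * max (norm e) \<bar>t\<bar> \<le> (1 + \<delta>) * max (norm e) \<bar>t\<bar>" for e :: 'a and t
    using assms(3) by (intro mult_right_mono) (auto simp: \<eta>_def max_def)
  from order_trans[OF up this] lo show ?thesis
    by (intro exI[of _ y]) (auto simp: \<eta>_def)
qed

section \<open>Iteration to a sequence equivalent to the unit vector basis\<close>

text \<open>The three conclusions are the two-sided estimate against \<open>max \<parallel>e\<parallel> (max\<^sub>k \<bar>a\<^sub>k\<bar>)\<close>, split so as
  to avoid a maximum over a possibly empty index set.\<close>

lemma almost_square_c0_sequence:
  fixes B :: "'a::banach set"
  assumes "almost_square TYPE('a)" "finite B" "0 < \<epsilon>" "\<epsilon> \<le> 1"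
  obtains y :: "nat \<Rightarrow> 'a" where
    "\<And>n e a M. e \<in> span B \<Longrightarrow> norm e \<le> M \<Longrightarrow> (\<And>k. k < n \<Longrightarrow> \<bar>a k\<bar> \<le> M) \<Longrightarrow>
       norm (e + (\<Sum>k<n. a k *\<^sub>R y k)) \<le> (1 + \<epsilon>) * M"
    "\<And>n e a. e \<in> span B \<Longrightarrow> (1 - \<epsilon>) * norm e \<le> norm (e + (\<Sum>k<n. a k *\<^sub>R y k))"
    "\<And>n e a k. e \<in> span B \<Longrightarrow> k < n \<Longrightarrow>
       (1 - \<epsilon>) * \<bar>a k\<bar> \<le> norm (e + (\<Sum>k<n. a k *\<^sub>R y k))"
proof -
  \<comment> \<open>The doubled losses \<open>2 * \<delta> n = \<epsilon> / 2 ^ (n + 1)\<close> of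
    all steps sum to exactly \<open>\<epsilon>\<close>.\<close>
  define \<delta> where "\<delta> n = \<epsilon> / 2 ^ (n + 2)" for n :: nat
  have \<delta>: "\<delta> n > 0" for n using assms(3) by (simp add: \<delta>_def)
  define good where "good A d y \<longleftrightarrow>
      (\<forall>e\<in>span A. \<forall>t. (1 - d) * max (norm e) \<bar>t\<bar> \<le> norm (e + t *\<^sub>R y) \<and>
                    norm (e + t *\<^sub>R y) \<le> (1 + d) * max (norm e) \<bar>t\<bar>)"
    for A :: "'a set" and d y
  define next_vec where "next_vec A n = (SOME y. good A (\<delta> n) y)" for A :: "'a set" and n
  \<comment> \<open>\<open>A n\<close> collects \<open>B\<close> and all earlier vectors, so that in
    step \<open>n\<close> the whole previous partial sum can take the place of \<open>e\<close> in
    \<open>good\<close>.\<close>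
  define A where "A = rec_nat B (\<lambda>n S. insert (next_vec S n) S)"
  define y where "y n = next_vec (A n) n" for n
  have A0: "A 0 = B" and AS: "A (Suc n) = insert (y n) (A n)" for n
    by (auto simp: A_def y_def)
  have finA: "finite (A n)" for n
    by (induction n) (auto simp: A0 AS assms(2))
  have good: "good (A n) (\<delta> n) (y n)" for n
    unfolding y_def next_vec_def
    using almost_square_extend[OF assms(1) finA[of n] \<delta>[of n]]
    unfolding good_def by (rule someI_ex)
  have inA: "e + (\<Sum>k<n. a k *\<^sub>R y k) \<in> span (A n)" if "e \<in> span B" for e a n
  proof (induction n)
    case 0
    then show ?case using that by (simp add: A0)
  next
    case (Suc n)
    have "e + (\<Sum>k<n. a k *\<^sub>R y k) \<in> span (A (Suc n))"
      using Suc span_mono[of "A n" "A (Suc n)"] by (auto simp: AS)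
    moreover have "a n *\<^sub>R y n \<in> span (A (Suc n))"
      by (intro span_scale span_base) (simp add: AS)
    ultimately show ?case by (simp add: span_add flip: add.assoc)
  qed
  \<comment> \<open>\<open>c n\<close> is the sum of \<open>2 * \<delta> k\<close> over
    \<open>k < n\<close>. The factor 2 absorbs the product of the new and the accumulated loss:
    \<open>\<delta> n * c n \<le> \<delta> n\<close>, because \<open>c n \<le> 1\<close>.\<close>
  define c where "c n = \<epsilon> * (1 - 1 / 2 ^ n)" for n :: nat
  have cS: "c (Suc n) = c n + 2 * \<delta> n" for n
    by (simp add: c_def \<delta>_def field_simps)
  have c0: "0 \<le> c n" and c\<epsilon>: "c n \<le> \<epsilon>" for n
    using assms(3) by (simp_all add: c_def mult_left_le)
  have c1: "c n \<le> 1" for n using c\<epsilon>[of n] assms(4) by simp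
  \<comment> \<open>The induction carries the accumulated loss \<open>c n\<close>, as the fixed
    constant \<open>\<epsilon>\<close> would not survive a step.\<close>
  have bounds: "norm (e + (\<Sum>k<n. a k *\<^sub>R y k)) \<le> (1 + c n) * M
      \<and> (1 - c n) * norm e \<le> norm (e + (\<Sum>k<n. a k *\<^sub>R y k))
      \<and> (\<forall>k<n. (1 - c n) * \<bar>a k\<bar> \<le> norm (e + (\<Sum>k<n. a k *\<^sub>R y k)))"
    if e: "e \<in> span B" "norm e \<le> M" "\<And>k. k < n \<Longrightarrow> \<bar>a k\<bar> \<le> M" for e a n M
    using e(3)
  proof (induction n)
    case 0
    then show ?case using e(2) by (simp add: c_def)
  next
    case (Suc n)
    define u where "u = e + (\<Sum>k<n. a k *\<^sub>R y k)"
    have sumS: "e + (\<Sum>k<Suc n. a k *\<^sub>R y k) = u + a n *\<^sub>R y n"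
      by (simp add: u_def algebra_simps)
    have M: "M \<ge> 0" using e(2) norm_ge_zero order_trans by blast
    have IH: "norm u \<le> (1 + c n) * M" "(1 - c n) * norm e \<le> norm u"
        "\<And>k. k < n \<Longrightarrow> (1 - c n) * \<bar>a k\<bar> \<le> norm u"
      using Suc by (auto simp: u_def)
    have up: "norm (u + a n *\<^sub>R y n) \<le> (1 + \<delta> n) * max (norm u) \<bar>a n\<bar>"
      and lo: "(1 - \<delta> n) * max (norm u) \<bar>a n\<bar> \<le> norm (u + a n *\<^sub>R y n)"
      using good[of n] inA[OF e(1), where n = n and a = a] unfolding good_def u_def by auto
    have "M \<le> (1 + c n) * M" using M c0[of n] by (simp add: mult_le_cancel_right1)
    then have "\<bar>a n\<bar> \<le> (1 + c n) * M" using Suc.prems[of n] by simp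
    then have "(1 + \<delta> n) * max (norm u) \<bar>a n\<bar> \<le> (1 + \<delta> n) * ((1 + c n) * M)"
      using IH(1) \<delta>[of n] by (intro mult_left_mono) auto
    also have "\<dots> \<le> (1 + c (Suc n)) * M"
    proof -
      have "\<delta> n * c n \<le> \<delta> n" using \<delta>[of n] c1[of n] by (simp add: mult_left_le)
      then have "(1 + \<delta> n) * (1 + c n) \<le> 1 + c (Suc n)" by (simp add: cS algebra_simps)
      then have "((1 + \<delta> n) * (1 + c n)) * M \<le> (1 + c (Suc n)) * M"
        using M by (rule mult_right_mono)
      then show ?thesis by (simp add: mult.assoc)
    qed
    finally have 1: "norm (u + a n *\<^sub>R y n) \<le> (1 + c (Suc n)) * M" using up by simp
    have \<delta>1: "\<delta> n \<le> 1"
    proof -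
      have "\<epsilon> \<le> 2 ^ (n + 2)" using assms(4) one_le_power[of "2::real" "n + 2"] by linarith
      then show ?thesis by (simp add: \<delta>_def field_simps)
    qed
    \<comment> \<open>Here \<open>r\<close> is \<open>norm e\<close>, an old coefficient or the new
      one, so that one computation covers all three lower estimates.\<close>
    have lower: "(1 - c (Suc n)) * r \<le> norm (u + a n *\<^sub>R y n)"
      if r: "(1 - c n) * r \<le> max (norm u) \<bar>a n\<bar>" "r \<ge> 0" for r
    proof -
      have "0 \<le> \<delta> n * c n" using \<delta>[of n] c0[of n] by simp
      then have "1 - c (Suc n) \<le> (1 - \<delta> n) * (1 - c n)"
        using \<delta>[of n] by (simp add: cS algebra_simps)
      then have "(1 - c (Suc n)) * r \<le> ((1 - \<delta> n) * (1 - c n)) * r"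
        using r(2) by (rule mult_right_mono)
      also have "\<dots> = (1 - \<delta> n) * ((1 - c n) * r)" by simp
      also have "\<dots> \<le> (1 - \<delta> n) * max (norm u) \<bar>a n\<bar>"
        using r(1) \<delta>1 by (intro mult_left_mono) auto
      finally show ?thesis using lo by simp
    qed
    have 2: "(1 - c (Suc n)) * norm e \<le> norm (u + a n *\<^sub>R y n)"
      using IH(2) by (intro lower) auto
    have "(1 - c n) * \<bar>a k\<bar> \<le> max (norm u) \<bar>a n\<bar>" if "k < Suc n" for k
    proof (cases "k = n")
      case True
      have "(1 - c n) * \<bar>a n\<bar> \<le> 1 * \<bar>a n\<bar>" using c0[of n] by (intro mult_right_mono) auto
      then show ?thesis using True by simp
    next
      case False
      then show ?thesis using IH(3)[of k] that by simp
    qed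
    then have "\<forall>k<Suc n. (1 - c (Suc n)) * \<bar>a k\<bar> \<le> norm (u + a n *\<^sub>R y n)"
      by (auto intro!: lower)
    with 1 2 show ?case by (simp only: sumS)
  qed
  have weaken: "(1 - \<epsilon>) * r \<le> (1 - c n) * r" if "r \<ge> 0" for r n
    using c\<epsilon>[of n] that by (intro mult_right_mono) auto
  \<comment> \<open>The lower estimates do not mention \<open>M\<close>, so any common bound may be
    fed into \<open>bounds\<close>, for instance this sum.\<close>
  have bounded: "\<exists>M. norm e \<le> M \<and> (\<forall>k<n. \<bar>a k\<bar> \<le> M)" for e :: 'a and a :: "nat \<Rightarrow> real" and n
    by (intro exI[of _ "norm e + (\<Sum>k<n. \<bar>a k\<bar>)"])
       (auto simp: sum_nonneg intro!: add_increasing member_le_sum)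
  show ?thesis
  proof (rule that[of y])
    fix n :: nat and e a M assume as: "e \<in> span B" "norm e \<le> M" "\<And>k. k < n \<Longrightarrow> \<bar>a k\<bar> \<le> M"
    then have "0 \<le> M" using norm_ge_zero order_trans by blast
    then have "(1 + c n) * M \<le> (1 + \<epsilon>) * M" using c\<epsilon>[of n] by (intro mult_right_mono) auto
    then show "norm (e + (\<Sum>k<n. a k *\<^sub>R y k)) \<le> (1 + \<epsilon>) * M"
      using conjunct1[OF bounds[OF as]] by (rule order_trans[rotated])
  next
    fix n :: nat and e a assume e: "e \<in> span B"
    obtain M where "norm e \<le> M" "\<And>k. k < n \<Longrightarrow> \<bar>a k\<bar> \<le> M"
      using bounded[where e = e and n = n and a = a] by blast
    from bounds[where n = n and a = a, OF e this] have "(1 - c n) * norm e \<le> norm (e + (\<Sum>k<n. a k *\<^sub>R y k))" by simp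
    then show "(1 - \<epsilon>) * norm e \<le> norm (e + (\<Sum>k<n. a k *\<^sub>R y k))"
      using weaken[of "norm e" n] by simp
  next
    fix n k :: nat and e a assume e: "e \<in> span B" and k: "k < n"
    obtain M where "norm e \<le> M" "\<And>k. k < n \<Longrightarrow> \<bar>a k\<bar> \<le> M"
      using bounded[where e = e and n = n and a = a] by blast
    from bounds[where n = n and a = a, OF e this] have "(1 - c n) * \<bar>a k\<bar> \<le> norm (e + (\<Sum>k<n. a k *\<^sub>R y k))"
      using k by simp
    then show "(1 - \<epsilon>) * \<bar>a k\<bar> \<le> norm (e + (\<Sum>k<n. a k *\<^sub>R y k))"
      using weaken[of "\<bar>a k\<bar>" n] by simp
  qed
qed

section \<open>The isomorphism from the sequence\<close>

lemma subspace_c0: "subspace c0"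
proof (rule subspaceI)
  fix a b assume "a \<in> c0" "b \<in> c0"
  then show "a + b \<in> c0"
    using tendsto_add[of "apply_bcontfun a" 0 sequentially "apply_bcontfun b" 0]
    by (simp add: c0_def plus_bcontfun.rep_eq)
next
  fix r a assume "a \<in> c0"
  then show "r *\<^sub>R a \<in> c0"
    using tendsto_mult_right_zero[of "apply_bcontfun a" sequentially r]
    by (simp add: c0_def scaleR_bcontfun.rep_eq)
qed (simp add: c0_def zero_bcontfun.rep_eq)

lemma max_norm_nonneg: "0 \<le> max_norm p"
  by (simp add: max_norm_def le_max_iff_disj)

text \<open>Nonnegativity of \<open>nW\<close> on \<open>W\<close> makes both bounds weaker as the
  constant grows. This reduces the theorem to small constants.\<close>

lemma eps_isometric_mono:
  assumes "eps_isometric \<delta> V nV W nW" "\<delta> \<le> \<epsilon>" "\<And>w. w \<in> W \<Longrightarrow> 0 \<le> nW w"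
  shows "eps_isometric \<epsilon> V nV W nW"
proof -
  have weaken: "(1 - \<epsilon>) * nW w \<le> (1 - \<delta>) * nW w" "(1 + \<delta>) * nW w \<le> (1 + \<epsilon>) * nW w" if "w \<in> W" for w
    using assms(2) assms(3)[OF that] by (auto intro!: mult_right_mono)
  obtain T where T: "bij_betw T W V" "\<forall>u\<in>W. \<forall>w\<in>W. T (u + w) = T u + T w"
      "\<forall>r. \<forall>w\<in>W. T (r *\<^sub>R w) = r *\<^sub>R T w"
      "\<forall>w\<in>W. (1 - \<delta>) * nW w \<le> nV (T w) \<and> nV (T w) \<le> (1 + \<delta>) * nW w"
    using assms(1) unfolding eps_isometric_def by blast
  have "\<forall>w\<in>W. (1 - \<epsilon>) * nW w \<le> nV (T w) \<and> nV (T w) \<le> (1 + \<epsilon>) * nW w"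
    using T(4) weaken by (blast intro: order_trans)
  with T(1-3) show ?thesis unfolding eps_isometric_def by blast
qed

theorem lemma2p6:
  fixes E :: "'a::banach set" and \<epsilon> :: real
  assumes "(UNIV :: 'a set) \<noteq> {0}"
    and "almost_square TYPE('a)"
    and "subspace E"
    and "\<exists>B. finite B \<and> E = span B"
    and "\<epsilon> > 0"
  shows "\<exists>Y :: 'a set. subspace Y \<and>
           eps_isometric \<epsilon> Y norm c0 norm \<and>
           E \<inter> Y = {0} \<and>
           eps_isometric \<epsilon> {e + y |e y. e \<in> E \<and> y \<in> Y} norm (E \<times> c0) max_norm"
proof -
  obtain B where B: "finite B" and E: "E = span B" using assms(4) by blast
  \<comment> \<open>Keeping \<open>1 - \<delta>\<close> positive makes the lower estimates force
    injectivity and allows division by \<open>1 - \<delta>\<close>.\<close>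
  define \<delta> where "\<delta> = min \<epsilon> (1 / 2)"
  have \<delta>: "0 < \<delta>" "\<delta> \<le> 1" "\<delta> < 1" "\<delta> \<le> \<epsilon>" using assms(5) by (auto simp: \<delta>_def)
  obtain y :: "nat \<Rightarrow> 'a" where
    up: "\<And>n e a M. e \<in> E \<Longrightarrow> norm e \<le> M \<Longrightarrow> (\<And>k. k < n \<Longrightarrow> \<bar>a k\<bar> \<le> M) \<Longrightarrow>
       norm (e + (\<Sum>k<n. a k *\<^sub>R y k)) \<le> (1 + \<delta>) * M"
    and lo1: "\<And>n e a. e \<in> E \<Longrightarrow> (1 - \<delta>) * norm e \<le> norm (e + (\<Sum>k<n. a k *\<^sub>R y k))"
    and lo2: "\<And>n e a k. e \<in> E \<Longrightarrow> k < n \<Longrightarrow>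
       (1 - \<delta>) * \<bar>a k\<bar> \<le> norm (e + (\<Sum>k<n. a k *\<^sub>R y k))"
    unfolding E by (fact almost_square_c0_sequence[OF assms(2) B \<delta>(1,2)])
  have E0: "0 \<in> E" by (simp add: E span_zero)
  have summ: "summable (\<lambda>k. apply_bcontfun a k *\<^sub>R y k)" if "a \<in> c0" for a
    unfolding summable_Cauchy
  proof (intro allI impI)
    fix r :: real assume r: "r > 0"
    have "\<forall>\<^sub>F k in sequentially. \<bar>apply_bcontfun a k\<bar> < r / 4"
      using that r tendstoD[of "apply_bcontfun a" 0 sequentially "r / 4"]
      by (simp add: c0_def dist_norm)
    then obtain N where N: "\<And>k. k \<ge> N \<Longrightarrow> \<bar>apply_bcontfun a k\<bar> < r / 4"
      by (auto simp: eventually_sequentially)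
    have "norm (\<Sum>k\<in>{m..<n}. apply_bcontfun a k *\<^sub>R y k) < r" if m: "m \<ge> N" for m n
    proof -
      \<comment> \<open>Zero coefficients below \<open>m\<close> turn the block into an initial sum,
        to which \<open>up\<close> applies with \<open>e = 0\<close>; the result is at most
        \<open>2 * (r / 4) < r\<close>.\<close>
      define b where "b k = (if k \<ge> m then apply_bcontfun a k else 0)" for k
      have "(\<Sum>k\<in>{m..<n}. apply_bcontfun a k *\<^sub>R y k) = (\<Sum>k<n. b k *\<^sub>R y k)"
        by (intro sum.mono_neutral_cong_left) (auto simp: b_def)
      moreover have b: "\<bar>b k\<bar> \<le> r / 4" for k
        using N[of k] m r by (auto simp: b_def)
      have "norm (0 + (\<Sum>k<n. b k *\<^sub>R y k)) \<le> (1 + \<delta>) * (r / 4)"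
        using r by (intro up E0 b) auto
      moreover have "(1 + \<delta>) * (r / 4) \<le> 2 * (r / 4)"
        using \<delta> r by (intro mult_right_mono) auto
      ultimately show ?thesis using r by (simp only: add_0_left)
    qed
    then show "\<exists>N. \<forall>m\<ge>N. \<forall>n. norm (\<Sum>k\<in>{m..<n}. apply_bcontfun a k *\<^sub>R y k) < r" by blast
  qed
  define S where "S a = (\<Sum>k. apply_bcontfun a k *\<^sub>R y k)" for a
  \<comment> \<open>The constants in the estimates for partial sums do not depend on the length, so
    they pass to the limit along this convergence.\<close>
  have lim: "(\<lambda>n. norm (e + (\<Sum>k<n. apply_bcontfun a k *\<^sub>R y k))) \<longlonglongrightarrow> norm (e + S a)"
    if "a \<in> c0" for e a
    using summable_LIMSEQ[OF summ[OF that]] unfolding S_def by (intro tendsto_intros)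
  have S_add: "S (a + b) = S a + S b" if "a \<in> c0" "b \<in> c0" for a b
    using suminf_add[OF summ summ, OF that]
    by (simp add: S_def plus_bcontfun.rep_eq scaleR_left_distrib)
  have S_scale: "S (r *\<^sub>R a) = r *\<^sub>R S a" if "a \<in> c0" for r a
    using suminf_scaleR_right[OF summ[OF that], of r]
    by (simp add: S_def scaleR_bcontfun.rep_eq)
  \<comment> \<open>\<open>T\<close> restricted to \<open>e = 0\<close> is \<open>S\<close>, so the
    two estimates for \<open>T\<close> also settle the claim about \<open>Y\<close>.\<close>
  define T where "T = (\<lambda>(e, a). e + S a)"
  have T_up: "norm (e + S a) \<le> (1 + \<delta>) * max (norm e) (norm a)" if "e \<in> E" "a \<in> c0" for e a
  proof (rule LIMSEQ_le_const2[OF lim[OF that(2)]], intro exI allI impI)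
    fix n
    have "\<bar>apply_bcontfun a k\<bar> \<le> norm a" for k using norm_bounded[of a k] by simp
    then show "norm (e + (\<Sum>k<n. apply_bcontfun a k *\<^sub>R y k)) \<le> (1 + \<delta>) * max (norm e) (norm a)"
      by (intro up that) (auto simp: le_max_iff_disj)
  qed
  have T_lo: "(1 - \<delta>) * max (norm e) (norm a) \<le> norm (e + S a)" if "e \<in> E" "a \<in> c0" for e a
  proof -
    have 1: "(1 - \<delta>) * norm e \<le> norm (e + S a)"
      by (rule LIMSEQ_le_const[OF lim[OF that(2)]]) (use lo1 that in blast)
    \<comment> \<open>The coefficient with index \<open>k\<close> enters the partial sums from
      length \<open>Suc k\<close> on; a bound that holds eventually is enough in the limit.\<close>
    have "(1 - \<delta>) * \<bar>apply_bcontfun a k\<bar> \<le> norm (e + S a)" for k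
      by (rule LIMSEQ_le_const[OF lim[OF that(2)]]) (use lo2 that in \<open>meson Suc_le_eq\<close>)
    then have "norm (apply_bcontfun a k) \<le> norm (e + S a) / (1 - \<delta>)" for k
      using \<delta>(3) by (simp add: field_simps)
    then have "norm a \<le> norm (e + S a) / (1 - \<delta>)" by (rule norm_bound)
    then have "(1 - \<delta>) * norm a \<le> norm (e + S a)"
      using \<delta>(3) by (simp add: field_simps)
    with 1 show ?thesis by (simp add: max_def)
  qed
  \<comment> \<open>The trivial kernel is used twice: on differences it gives injectivity of
    \<open>T\<close>, hence of \<open>S\<close>, and on the pair \<open>(S a, - a)\<close> it gives
    the trivial intersection of \<open>E\<close> and \<open>Y\<close>.\<close>
  have kernel: "e = 0 \<and> a = 0" if "e \<in> E" "a \<in> c0" "e + S a = 0" for e a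
  proof -
    have "(1 - \<delta>) * max (norm e) (norm a) \<le> 0" using T_lo[OF that(1,2)] that(3) by simp
    then have "max (norm e) (norm a) \<le> 0" using \<delta>(3) by (simp add: mult_le_0_iff)
    then show ?thesis by simp
  qed
  have c0_diff: "a - b \<in> c0" if "a \<in> c0" "b \<in> c0" for a b
    using that subspace_c0 by (rule_tac subspace_diff)
  have S_diff: "S (a - b) = S a - S b" if "a \<in> c0" "b \<in> c0" for a b
    using S_add[OF c0_diff[OF that] that(2)] by simp
  have inj_T: "inj_on T (E \<times> c0)"
  proof (rule inj_onI, clarify)
    fix e a e' a' assume as: "e \<in> E" "a \<in> c0" "e' \<in> E" "a' \<in> c0" "T (e, a) = T (e', a')"
    then have "(e - e') + S (a - a') = 0" by (simp add: S_diff T_def algebra_simps)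
    with kernel[of "e - e'" "a - a'"] as show "e = e' \<and> a = a'"
      using assms(3) by (auto simp: c0_diff subspace_diff)
  qed
  have inj_S: "inj_on S c0"
  proof (rule inj_onI)
    fix a b assume "a \<in> c0" "b \<in> c0" "S a = S b"
    then show "a = b" using inj_onD[OF inj_T, of "(0, a)" "(0, b)"] E0 by (simp add: T_def)
  qed
  define Y where "Y = S ` c0"
  have Y: "subspace Y"
  proof (rule subspaceI)
    show "0 \<in> Y"
      unfolding Y_def using subspace_0[OF subspace_c0] S_scale[of 0 0] by force
    show "u + v \<in> Y" if "u \<in> Y" "v \<in> Y" for u v
      using that subspace_add[OF subspace_c0] by (auto simp: Y_def simp flip: S_add)
    show "r *\<^sub>R u \<in> Y" if "u \<in> Y" for r u
      using that subspace_scale[OF subspace_c0] by (auto simp: Y_def simp flip: S_scale)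
  qed
  have iso_Y: "eps_isometric \<delta> Y norm c0 norm"
    unfolding eps_isometric_def
  proof (intro exI[of _ S] conjI ballI allI)
    show "bij_betw S c0 Y" using inj_S by (simp add: Y_def bij_betw_def)
  next
    fix a assume a: "a \<in> c0"
    show "(1 - \<delta>) * norm a \<le> norm (S a)" "norm (S a) \<le> (1 + \<delta>) * norm a"
      using T_lo[OF E0 a] T_up[OF E0 a] by auto
  qed (auto simp: S_add S_scale)
  have E_Y: "E \<inter> Y = {0}"
  proof -
    have "S a = 0" if "S a \<in> E" "a \<in> c0" for a
      using kernel[of "S a" "(-1) *\<^sub>R a"] that S_scale[of a "-1"] subspace_neg[OF subspace_c0]
      by auto
    then show ?thesis
      using E0 subspace_0[OF Y] by (auto simp: Y_def)
  qed
  have iso_sum: "eps_isometric \<delta> {e + y |e y. e \<in> E \<and> y \<in> Y} norm (E \<times> c0) max_norm"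
    unfolding eps_isometric_def
  proof (intro exI[of _ T] conjI ballI allI)
    have "T ` (E \<times> c0) = {e + y |e y. e \<in> E \<and> y \<in> Y}"
      by (force simp: T_def Y_def)
    then show "bij_betw T (E \<times> c0) {e + y |e y. e \<in> E \<and> y \<in> Y}"
      using inj_T by (simp add: bij_betw_def)
  next
    fix p assume "p \<in> E \<times> c0"
    then show "(1 - \<delta>) * max_norm p \<le> norm (T p)" "norm (T p) \<le> (1 + \<delta>) * max_norm p"
      using T_lo T_up by (auto simp: T_def max_norm_def)
  qed (auto simp: T_def S_add S_scale algebra_simps)
  show ?thesis
    using Y E_Y eps_isometric_mono[OF iso_Y \<delta>(4) norm_ge_zero]
      eps_isometric_mono[OF iso_sum \<delta>(4) max_norm_nonneg] by (intro exI[of _ Y] conjI)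
qed

end
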